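(* $\mathrm{BRV}\subseteq T[H^\infty]$; that is, if $g\in H(\mathbb{D})$ satisfies $\sup_{0\le\theta<2\pi}\int_0^1|g'(te^{i\theta})|\,dt<\infty$, then $T_g$ is a bounded operator on $H^\infty$.
   Context: $\mathbb{D}$ is the open unit disk, $H(\mathbb{D})$ the set of analytic functions on $\mathbb{D}$, and $H^\infty$ the Banach space of bounded analytic functions on $\mathbb{D}$ with the supremum norm. For $g\in H(\mathbb{D})$, $T_gf(z)=\int_0^z f(t)g'(t)\,dt$ for $z\in\mathbb{D}$, $f\in H(\mathbb{D})$. $T[H^\infty]=\{g\in H(\mathbb{D}): T_g\text{ maps }H^\infty\text{ boundedly into }H^\infty\}$. The radial variation of $g$ is $V(g,\theta)=\int_0^1|g'(te^{i\theta})|\,dt$, $0\le\theta<2\pi$, and $\mathrm{BRV}=\{g\in H(\mathbb{D}):\sup_\theta V(g,\theta)<\infty\}$. *)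

theory Defs
  imports "HOL-Complex_Analysis.Complex_Analysis"
begin

text \<open>
  Functions on the unit disk are represented by total functions on \<^typ>\<open>complex\<close>;
  their values outside the open disk are irrelevant to every notion below.
\<close>

abbreviation unit_disk :: "complex set" where
  "unit_disk \<equiv> ball 0 1"

definition H_disk :: "(complex \<Rightarrow> complex) set" where
  "H_disk = {f. f holomorphic_on unit_disk}"

definition H_inf :: "(complex \<Rightarrow> complex) set" where
  "H_inf = {f \<in> H_disk. bounded (f ` unit_disk)}"

definition H_inf_norm :: "(complex \<Rightarrow> complex) \<Rightarrow> real" where
  "H_inf_norm f = (SUP z\<in>unit_disk. cmod (f z))"

text \<open>
  The integrand is holomorphic on the disk when \<open>f\<close> and \<open>g\<close> are, so the integral from
  \<open>0\<close> to \<open>z\<close> does not depend on the path; the straight segment is used.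
\<close>

definition T_op :: "(complex \<Rightarrow> complex) \<Rightarrow> (complex \<Rightarrow> complex) \<Rightarrow> complex \<Rightarrow> complex" where
  "T_op g f z = contour_integral (linepath 0 z) (\<lambda>t. f t * deriv g t)"

text \<open>
  Linearity is only required on the disk, since elements of \<^const>\<open>H_inf\<close> are functions on
  the disk.
\<close>

definition bounded_operator_H_inf :: "((complex \<Rightarrow> complex) \<Rightarrow> complex \<Rightarrow> complex) \<Rightarrow> bool" where
  "bounded_operator_H_inf T \<longleftrightarrow>
     (\<forall>f\<in>H_inf. T f \<in> H_inf) \<and>
     (\<forall>f\<in>H_inf. \<forall>h\<in>H_inf. \<forall>a b. \<forall>z\<in>unit_disk.
        T (\<lambda>w. a * f w + b * h w) z = a * T f z + b * T h z) \<and>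
     (\<exists>C. \<forall>f\<in>H_inf. H_inf_norm (T f) \<le> C * H_inf_norm f)"

definition T_H_inf :: "(complex \<Rightarrow> complex) set" where
  "T_H_inf = {g \<in> H_disk. bounded_operator_H_inf (T_op g)}"

text \<open>
  The variation may be infinite, hence the extended nonnegative integral. The endpoint
  \<open>t = 1\<close>, where \<^term>\<open>deriv g\<close> is meaningless, is left out.
\<close>

definition radial_variation :: "(complex \<Rightarrow> complex) \<Rightarrow> real \<Rightarrow> ennreal" where
  "radial_variation g \<theta> =
     (\<integral>\<^sup>+t\<in>{0..<1}. ennreal (cmod (deriv g (of_real t * exp (\<i> * of_real \<theta>)))) \<partial>lborel)"

definition BRV :: "(complex \<Rightarrow> complex) set" where
  "BRV = {g \<in> H_disk. (SUP \<theta>\<in>{0..<2*pi}. radial_variation g \<theta>) < \<infinity>}"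

end

theory Submission
  imports Defs
begin

text \<open>
  The integral defining \<^term>\<open>T_op g f z\<close> runs along the radius through \<open>z\<close>. On that radius
  \<open>f\<close> is at most its supremum norm, so the integral is at most that norm times the length of
  the image under \<open>g\<close> of the segment from \<open>0\<close> to \<open>z\<close>. This length is a part of the radial
  variation of \<open>g\<close> in the direction of \<open>z\<close> (lemma \<open>radial_segment_length_le\<close>), hence at most
  the supremum of all radial variations. That supremum is therefore a bound for the operator
  norm of \<^term>\<open>T_op g\<close>.

  The function \<^term>\<open>T_op g f\<close> is holomorphic because the disk is convex: there
  \<^term>\<open>\<lambda>w. f w * deriv g w\<close> has a primitive, and \<^term>\<open>T_op g f\<close> is the one
  that vanishes at \<open>0\<close>.
\<close>

lemma segment_subset_unit_disk:
  assumes "z \<in> unit_disk"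
  shows "closed_segment 0 z \<subseteq> unit_disk"
  using assms by (intro closed_segment_subset) auto

lemma T_integrand_holomorphic:
  assumes "f \<in> H_disk" "g \<in> H_disk"
  shows "(\<lambda>w. f w * deriv g w) holomorphic_on unit_disk"
  using assms by (auto simp: H_disk_def intro!: holomorphic_intros)

lemma T_integrand_contour_integrable:
  assumes "f \<in> H_disk" "g \<in> H_disk" "z \<in> unit_disk"
  shows "(\<lambda>w. f w * deriv g w) contour_integrable_on linepath 0 z"
  using contour_integrable_holomorphic_simple[OF T_integrand_holomorphic[OF assms(1,2)]]
    segment_subset_unit_disk[OF assms(3)] by simp

lemma T_op_holomorphic:
  assumes "f \<in> H_disk" "g \<in> H_disk"
  shows "T_op g f holomorphic_on unit_disk"
proof -
  obtain F where F: "\<And>w. w \<in> unit_disk \<Longrightarrow>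
      (F has_field_derivative f w * deriv g w) (at w within unit_disk)"
    using holomorphic_convex_primitive'[OF convex_ball open_ball T_integrand_holomorphic[OF assms]]
    by blast
  have T_eq: "T_op g f z = F z - F 0" if "z \<in> unit_disk" for z
  proof -
    have "((\<lambda>w. f w * deriv g w) has_contour_integral (F z - F 0)) (linepath 0 z)"
      using contour_integral_primitive[OF F, where g = "linepath 0 z"]
        segment_subset_unit_disk[OF that] by simp
    then show ?thesis
      by (simp add: T_op_def contour_integral_unique)
  qed
  have "F holomorphic_on unit_disk"
    using F unfolding holomorphic_on_def field_differentiable_def by blast
  then have "(\<lambda>z. F z - F 0) holomorphic_on unit_disk"
    by (intro holomorphic_intros)
  then show ?thesis
    using T_eq holomorphic_cong by (metis (no_types, lifting))
qed

lemma T_op_linear: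
  assumes "f \<in> H_disk" "h \<in> H_disk" "g \<in> H_disk" "z \<in> unit_disk"
  shows "T_op g (\<lambda>w. a * f w + b * h w) z = a * T_op g f z + b * T_op g h z"
proof -
  have "((\<lambda>w. a * (f w * deriv g w) + b * (h w * deriv g w))
      has_contour_integral a * T_op g f z + b * T_op g h z) (linepath 0 z)"
    unfolding T_op_def
    using T_integrand_contour_integrable assms
    by (intro has_contour_integral_add has_contour_integral_lmul has_contour_integral_integral)
  then show ?thesis
    unfolding T_op_def by (simp add: contour_integral_unique algebra_simps)
qed

lemma norm_le_H_inf_norm:
  assumes "f \<in> H_inf" "z \<in> unit_disk"
  shows "cmod (f z) \<le> H_inf_norm f"
proof -
  have "bdd_above ((\<lambda>z. cmod (f z)) ` unit_disk)"
    using assms(1) by (auto simp: H_inf_def bounded_iff bdd_above_def)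
  then show ?thesis
    unfolding H_inf_norm_def using assms(2) by (rule cSUP_upper2) auto
qed

text \<open>
  The substitution \<open>t = \<bar>z\<bar> x\<close> turns the speed of \<open>g\<close> along \<^term>\<open>linepath 0 z\<close> into
  the integrand of the radial variation, now on the shorter interval \<open>[0, \<bar>z\<bar>]\<close>.
\<close>

lemma radial_segment_length_le:
  assumes g: "g \<in> H_disk" and z: "z \<in> unit_disk"
  shows "ennreal (integral {0..1} (\<lambda>x. cmod (deriv g (of_real x * z)) * cmod z))
           \<le> radial_variation g (Arg2pi z)"
proof (cases "z = 0")
  case True
  then show ?thesis by simp
next
  case False
  define r where "r = cmod z"
  define e where "e = exp (\<i> * of_real (Arg2pi z))"
  have r: "0 < r" "r < 1" using False z by (auto simp: r_def)
  have ze: "z = of_real r * e"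
    unfolding r_def e_def by (rule Arg2pi_eq)
  have norm_e: "cmod e = 1" by (simp add: e_def)
  define k where "k t = cmod (deriv g (of_real t * e))" for t :: real
  have dg: "continuous_on unit_disk (deriv g)"
    using g by (auto simp: H_disk_def intro!: holomorphic_on_imp_continuous_on holomorphic_intros)
  have cont_k: "continuous_on {0..r} k"
    unfolding k_def using r norm_e
    by (intro continuous_on_norm continuous_on_compose2[OF dg] continuous_intros)
       (auto simp: norm_mult)
  have cont: "continuous_on {0..1} (\<lambda>x. k (r * x) * r)"
    using r by (intro continuous_intros continuous_on_compose2[OF cont_k])
      (auto simp: mult_left_le)
  have k_nonneg: "0 \<le> k t" for t by (simp add: k_def)
  let ?K = "\<lambda>t. ennreal (k t) * indicator {0..r} t"
  have [measurable]: "?K \<in> borel_measurable borel"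
  proof -
    have "(\<lambda>t. indicator {0..r} t *\<^sub>R k t) \<in> borel_measurable borel"
      using cont_k by (intro borel_measurable_continuous_on_indicator) auto
    then have "(\<lambda>t. ennreal (indicator {0..r} t *\<^sub>R k t)) \<in> borel_measurable borel"
      by measurable
    also have "(\<lambda>t. ennreal (indicator {0..r} t *\<^sub>R k t)) = ?K"
      by (auto simp: indicator_def)
    finally show ?thesis .
  qed
  have "ennreal (integral {0..1} (\<lambda>x. k (r * x) * r))
      = (\<integral>\<^sup>+x. ennreal (k (r * x) * r) * indicator {0..1} x \<partial>lborel)"
    using nn_integral_has_integral_lebesgue[OF _ integrable_integral[OF
        integrable_continuous_interval[OF cont]]] r k_nonneg
    unfolding nn_integral_set_ennreal by (simp add: mult.commute)
  also have "\<dots> = (\<integral>\<^sup>+x. ennreal r * ?K (0 + r * x) \<partial>lborel)"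
    using r k_nonneg
    by (intro nn_integral_cong) (auto simp: indicator_def ennreal_mult' mult.commute zero_le_mult_iff)
  also have "\<dots> = ennreal \<bar>r\<bar> * (\<integral>\<^sup>+x. ?K (0 + r * x) \<partial>lborel)"
    using r by (subst nn_integral_cmult) auto
  also have "\<dots> = (\<integral>\<^sup>+t. ?K t \<partial>lborel)"
    using r by (intro nn_integral_real_affine[symmetric]) auto
  also have "\<dots> \<le> (\<integral>\<^sup>+t. ennreal (k t) * indicator {0..<1} t \<partial>lborel)"
    using r by (intro nn_integral_mono) (auto simp: indicator_def)
  also have "\<dots> = radial_variation g (Arg2pi z)"
    by (simp add: radial_variation_def k_def e_def)
  finally show ?thesis
    by (simp add: k_def ze norm_mult norm_e mult_ac abs_of_pos[OF r(1)])
qed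

lemma norm_T_op_le:
  assumes f: "f \<in> H_inf" and g: "g \<in> H_disk" and z: "z \<in> unit_disk"
    and M: "radial_variation g (Arg2pi z) \<le> ennreal M" "0 \<le> M"
  shows "cmod (T_op g f z) \<le> M * H_inf_norm f"
proof -
  have fD: "f \<in> H_disk" using f by (simp add: H_inf_def)
  let ?v = "\<lambda>x. cmod (deriv g (of_real x * z)) * cmod z"
  have in_disk: "of_real x * z \<in> unit_disk" if "x \<in> {0..1}" for x :: real
    using that z mult_left_le_one_le[of "cmod z" x] by (auto simp: norm_mult)
  have dg: "continuous_on unit_disk (deriv g)"
    using g by (auto simp: H_disk_def intro!: holomorphic_on_imp_continuous_on holomorphic_intros)
  have "continuous_on {0..1} (\<lambda>x. deriv g (of_real x * z))"
    by (rule continuous_on_compose2[OF dg]) (use in_disk in \<open>auto intro!: continuous_intros\<close>)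
  then have v_int: "?v integrable_on {0..1}"
    by (intro integrable_continuous_interval continuous_intros)
  have T_int: "((\<lambda>x. f (of_real x * z) * deriv g (of_real x * z) * z) has_integral T_op g f z) {0..1}"
    using has_contour_integral_integral[OF T_integrand_contour_integrable[OF fD g z]]
    unfolding T_op_def has_contour_integral_linepath
    by (simp add: linepath_def scaleR_conv_of_real)
  have "cmod (T_op g f z) \<le> integral {0..1} (\<lambda>x. H_inf_norm f * ?v x)"
    unfolding integral_unique[OF T_int, symmetric]
  proof (rule integral_norm_bound_integral)
    show "(\<lambda>x. H_inf_norm f * ?v x) integrable_on {0..1}"
      using v_int by (rule integrable_on_mult_right)
    show "cmod (f (of_real x * z) * deriv g (of_real x * z) * z) \<le> H_inf_norm f * ?v x"
      if "x \<in> {0..1}" for x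
      using norm_le_H_inf_norm[OF f in_disk[OF that]]
      by (simp add: norm_mult mult.assoc mult_right_mono)
  qed (use T_int in blast)
  also have "\<dots> = H_inf_norm f * integral {0..1} ?v"
    by simp
  also have "\<dots> \<le> H_inf_norm f * M"
  proof (rule mult_left_mono)
    show "integral {0..1} ?v \<le> M"
      using order_trans[OF radial_segment_length_le[OF g z] M(1)] M(2) by simp
    show "0 \<le> H_inf_norm f"
      using norm_le_H_inf_norm[OF f z] norm_ge_zero order_trans by blast
  qed
  finally show ?thesis by (simp add: mult.commute)
qed

theorem proposition2p4:
  shows "BRV \<subseteq> T_H_inf"
proof
  fix g assume "g \<in> BRV"
  then have g: "g \<in> H_disk" and fin: "(SUP \<theta>\<in>{0..<2*pi}. radial_variation g \<theta>) < \<infinity>"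
    by (auto simp: BRV_def)
  define M where "M = enn2real (SUP \<theta>\<in>{0..<2*pi}. radial_variation g \<theta>)"
  have M: "radial_variation g (Arg2pi z) \<le> ennreal M" for z
  proof -
    have "radial_variation g (Arg2pi z) \<le> (SUP \<theta>\<in>{0..<2*pi}. radial_variation g \<theta>)"
      by (rule SUP_upper) (simp add: Arg2pi_ge_0 Arg2pi_lt_2pi)
    then show ?thesis using fin by (simp add: M_def)
  qed
  have bound: "cmod (T_op g f z) \<le> M * H_inf_norm f" if "f \<in> H_inf" "z \<in> unit_disk" for f z
    by (rule norm_T_op_le[OF that(1) g that(2) M]) (simp add: M_def)
  have "T_op g f \<in> H_inf" if "f \<in> H_inf" for f
  proof -
    have "bounded (T_op g f ` unit_disk)"
      using bound[OF that] by (intro boundedI[of _ "M * H_inf_norm f"]) auto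
    then show ?thesis
      using that T_op_holomorphic[OF _ g] by (auto simp: H_inf_def H_disk_def)
  qed
  moreover have "H_inf_norm (T_op g f) \<le> M * H_inf_norm f" if "f \<in> H_inf" for f
    unfolding H_inf_norm_def[of "T_op g f"] using bound[OF that] by (intro cSUP_least) auto
  moreover have "T_op g (\<lambda>w. a * f w + b * h w) z = a * T_op g f z + b * T_op g h z"
    if "f \<in> H_inf" "h \<in> H_inf" "z \<in> unit_disk" for f h a b z
    using that g by (intro T_op_linear) (auto simp: H_inf_def)
  ultimately show "g \<in> T_H_inf"
    using g by (auto simp: T_H_inf_def bounded_operator_H_inf_def)
qed

end
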